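(* Let $G$ be a subcubic graph and let $S(G)$ be a genuine subdivision of $G$. Then $S(G)$ admits a crumby coloring.
   Context: A graph is subcubic if it has maximum degree at most $3$. A genuine subdivision of a graph $G$ is a graph obtained from $G$ by replacing each edge by a path with at least one internal (subdivision) vertex, i.e. every edge of $G$ is subdivided at least once. A crumby coloring of a graph $H$ is a coloring of the vertices of $H$ with two colors, red and blue, such that the subgraph induced by the blue vertices has maximum degree at most $1$, and the subgraph induced by the red vertices has minimum degree at least $1$ and contains no path with $3$ edges. *)

theory Defs
  imports "Graph_Theory.Graph_Theory"
begin

text \<open>
  A finite simple undirected graph is a \<^locale>\<open>pair_graph\<close>: every undirected edge is
  represented by the two opposite arcs \<open>(u, v)\<close> and \<open>(v, u)\<close>, so the degree of a vertex is
  its out-degree.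
\<close>

definition subcubic :: "'a pair_pre_digraph \<Rightarrow> bool" where
  "subcubic G \<longleftrightarrow> (\<forall>v \<in> pverts G. out_degree (with_proj G) v \<le> 3)"

text \<open>
  \<open>\<iota> (u, v)\<close> lists the internal vertices, from \<open>u\<close> to \<open>v\<close>, of the path that replaces the edge
  \<open>uv\<close>. The two arcs of an edge describe the same path, traversed in opposite directions. The
  vertices of \<open>G\<close> are kept, the internal vertices are new, and different edges have disjoint
  sets of internal vertices.
\<close>

definition genuine_subdivision :: "'a pair_pre_digraph \<Rightarrow> 'a pair_pre_digraph \<Rightarrow> bool" where
  "genuine_subdivision G S \<longleftrightarrow> (\<exists>\<iota> :: 'a \<times> 'a \<Rightarrow> 'a list.
     (\<forall>(u, v) \<in> parcs G.
        \<iota> (v, u) = rev (\<iota> (u, v)) \<and> \<iota> (u, v) \<noteq> [] \<and> distinct (\<iota> (u, v)) \<and>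
        set (\<iota> (u, v)) \<inter> pverts G = {}) \<and>
     (\<forall>(u, v) \<in> parcs G. \<forall>(x, y) \<in> parcs G.
        {u, v} \<noteq> {x, y} \<longrightarrow> set (\<iota> (u, v)) \<inter> set (\<iota> (x, y)) = {}) \<and>
     pverts S = pverts G \<union> (\<Union>e \<in> parcs G. set (\<iota> e)) \<and>
     parcs S = (\<Union>(u, v) \<in> parcs G. set (vwalk_arcs (u # \<iota> (u, v) @ [v]))))"

datatype color = Red | Blue

definition color_class :: "'a pair_pre_digraph \<Rightarrow> ('a \<Rightarrow> color) \<Rightarrow> color \<Rightarrow> 'a set" where
  "color_class H c k = {v \<in> pverts H. c v = k}"

definition crumby_coloring :: "'a pair_pre_digraph \<Rightarrow> ('a \<Rightarrow> color) \<Rightarrow> bool" where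
  "crumby_coloring H c \<longleftrightarrow>
     (let R = with_proj H \<restriction> color_class H c Red;
          B = with_proj H \<restriction> color_class H c Blue
      in (\<forall>v \<in> verts B. out_degree B v \<le> 1) \<and>
         (\<forall>v \<in> verts R. 1 \<le> out_degree R v) \<and>
         \<not> (\<exists>u p v. pre_digraph.apath R u p v \<and> length p = 3))"

end

theory Submission
  imports Defs
begin

text \<open>
  Call an edge short if it carries one subdivision vertex and long otherwise. Choose a maximal
  set \<open>A\<close> of vertices with at most one incident long edge such that no short edge has both ends
  in \<open>A\<close>. Colour \<open>A\<close> blue and all other vertices of \<open>G\<close> red. A vertex of \<open>A\<close> can afford a blue
  neighbour on its only long edge. A red vertex that has a short edge to \<open>A\<close> gets the vertex
  subdividing this edge as a red neighbour. By maximality, every remaining red vertex has at least two long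
  edges, and it needs a red neighbour on one of them. Almost every long edge can provide one to
  either of its ends, so it is enough to choose for each remaining vertex one of its long
  edges, no edge being chosen twice. This is possible because a component of the graph of
  long edges between the remaining vertices that has no long edge leaving it has minimum degree at
  least 2 and therefore contains a cycle. The only exceptional edges are those with three
  subdivision vertices that end in \<open>A\<close>: their other end has to be a leaf of a red star, so
  they are used as rarely as possible.
\<close>

subsection \<open>Words along a subdivided edge\<close>

text \<open>
  \<open>Bl\<close> is a blue vertex, \<open>Ce\<close> the centre and \<open>Le\<close> a leaf of a red star. A red component with one
  edge is a star too: one of its two vertices is declared to be the centre.
\<close>

datatype letter = Bl | Ce | Le

text \<open>The middle letter stands for a vertex of degree 2. The clauses are chosen so that red
  components come out as stars with at least one edge, which contain no path with three
  edges.\<close>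

fun local_ok :: "letter \<Rightarrow> letter \<Rightarrow> letter \<Rightarrow> bool" where
  "local_ok a Bl b \<longleftrightarrow> \<not> (a = Bl \<and> b = Bl)"
| "local_ok a Ce b \<longleftrightarrow> a \<noteq> Ce \<and> b \<noteq> Ce \<and> (a = Le \<or> b = Le)"
| "local_ok a Le b \<longleftrightarrow> a = Ce \<and> b = Bl \<or> a = Bl \<and> b = Ce"

fun ok_word :: "letter list \<Rightarrow> bool" where
  "ok_word (a # x # b # xs) \<longleftrightarrow> local_ok a x b \<and> ok_word (x # b # xs)"
| "ok_word _ \<longleftrightarrow> True"

lemma local_ok_commute: "local_ok a x b \<longleftrightarrow> local_ok b x a"
  by (cases x) auto

lemma ok_word_conv_nth:
  "ok_word xs \<longleftrightarrow> (\<forall>i. Suc (Suc i) < length xs \<longrightarrow> local_ok (xs ! i) (xs ! Suc i) (xs ! Suc (Suc i)))"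
proof (induction xs rule: ok_word.induct)
  case (1 a x b xs)
  show ?case
    unfolding ok_word.simps 1
  proof (intro iffI conjI allI impI)
    fix i
    assume "local_ok a x b \<and> (\<forall>i. Suc (Suc i) < length (x # b # xs) \<longrightarrow>
        local_ok ((x # b # xs) ! i) ((x # b # xs) ! Suc i) ((x # b # xs) ! Suc (Suc i)))"
      and "Suc (Suc i) < length (a # x # b # xs)"
    then show "local_ok ((a # x # b # xs) ! i) ((a # x # b # xs) ! Suc i) ((a # x # b # xs) ! Suc (Suc i))"
      by (cases i) auto
  qed fastforce+
qed auto

lemma ok_word_rev:
  assumes "ok_word xs"
  shows "ok_word (rev xs)"
  unfolding ok_word_conv_nth
proof (intro allI impI)
  fix i assume i: "Suc (Suc i) < length (rev xs)"
  define j where "j = length xs - Suc (Suc (Suc i))"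
  have "local_ok (xs ! j) (xs ! Suc j) (xs ! Suc (Suc j))"
    using assms i by (auto simp: ok_word_conv_nth j_def)
  moreover have "length xs - Suc i = Suc (Suc j)" "length xs - Suc (Suc i) = Suc j"
    using i by (auto simp: j_def)
  ultimately show "local_ok (rev xs ! i) (rev xs ! Suc i) (rev xs ! Suc (Suc i))"
    using i by (simp add: rev_nth local_ok_commute flip: j_def)
qed

text \<open>The block \<open>Bl, Ce, Le\<close> can be put in front of any such word, which reduces
  the length by 3. Length 3 fails because a letter between two blue ones can be neither blue nor
  red; hence length 6 does not reduce and needs a word of its own.\<close>

lemma ex_word_red_red:
  assumes "n \<ge> 1" "n \<noteq> 3"
  shows "\<exists>w. length (Bl # w) = n \<and> last (Bl # w) = Bl \<and>
    (\<forall>a b. a \<noteq> Bl \<longrightarrow> b \<noteq> Bl \<longrightarrow> ok_word (a # Bl # w @ [b]))"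
  using assms
proof (induction n rule: less_induct)
  case (less n)
  consider "n = 1" | "n = 2" | "n = 4" | "n = 5" | "n = 6" | "n \<ge> 7"
    using less.prems by linarith
  then show ?case
  proof cases
    case 6
    then have le: "n - 3 \<ge> 1" and diff: "n - 3 \<noteq> 3" by auto
    obtain w where w: "length (Bl # w) = n - 3" "last (Bl # w) = Bl"
      "\<forall>a b. a \<noteq> Bl \<longrightarrow> b \<noteq> Bl \<longrightarrow> ok_word (a # Bl # w @ [b])"
      using less.IH[of "n - 3", OF _ le diff] 6 by auto
    then show ?thesis
      using 6 by (intro exI[of _ "[Ce, Le, Bl] @ w"]) auto
  next
    case 1 then show ?thesis by (intro exI[of _ "[]"]) auto
  next
    case 2 then show ?thesis by (intro exI[of _ "[Bl]"]) auto
  next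
    case 3 then show ?thesis by (intro exI[of _ "[Ce, Le, Bl]"]) auto
  next
    case 4 then show ?thesis by (intro exI[of _ "[Ce, Le, Bl, Bl]"]) auto
  next
    case 5 then show ?thesis by (intro exI[of _ "[Bl, Ce, Le, Bl, Bl]"]) auto
  qed
qed

text \<open>Prepending the same block leaves one base word for each residue modulo 3.\<close>

lemma ex_word_red_blue:
  assumes "n \<ge> 3"
  shows "\<exists>w. length (Bl # w) = n \<and> (\<forall>a. a \<noteq> Bl \<longrightarrow> ok_word (a # Bl # w @ [Bl]))"
  using assms
proof (induction n rule: less_induct)
  case (less n)
  consider "n = 3" | "n = 4" | "n = 5" | "n \<ge> 6"
    using less.prems by linarith
  then show ?case
  proof cases
    case 4
    then have le: "n - 3 \<ge> 3" by auto
    obtain w where w: "length (Bl # w) = n - 3"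
      "\<forall>a. a \<noteq> Bl \<longrightarrow> ok_word (a # Bl # w @ [Bl])"
      using less.IH[of "n - 3", OF _ le] 4 by auto
    then show ?thesis
      using 4 by (intro exI[of _ "[Ce, Le, Bl] @ w"]) auto
  next
    case 1 then show ?thesis by (intro exI[of _ "[Ce, Le]"]) auto
  next
    case 2 then show ?thesis by (intro exI[of _ "[Le, Ce, Le]"]) auto
  next
    case 3 then show ?thesis by (intro exI[of _ "[Bl, Le, Ce, Le]"]) auto
  qed
qed

text \<open>
  Here \<open>n\<close> is the number of internal vertices on the path that replaces an edge \<open>uv\<close>, \<open>a\<close> and \<open>b\<close> are
  the letters of \<open>u\<close> and \<open>v\<close>, and the flag \<open>d\<close> says that \<open>u\<close> relies on this edge for a red
  neighbour. If \<open>a = Bl\<close>, the word may start with \<open>Bl\<close> when \<open>2 \<le> n\<close> because a blue vertex of \<open>G\<close>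
  will have at most one incident edge of this kind.
\<close>

fun end_ok :: "nat \<Rightarrow> letter \<Rightarrow> bool \<Rightarrow> letter \<Rightarrow> bool" where
  "end_ok n Bl d x \<longleftrightarrow> (x = Bl \<longrightarrow> 2 \<le> n)"
| "end_ok n Ce d x \<longleftrightarrow> x \<noteq> Ce \<and> (d \<longrightarrow> x = Le)"
| "end_ok n Le d x \<longleftrightarrow> x = (if d then Ce else Bl)"

text \<open>Asked at both ends, this suffices for a word unless two \<open>Ce\<close> ends rely on
  the same edge. A flagged \<open>Ce\<close> end forces the path to continue with
  \<open>Le, Bl\<close>; if \<open>n = 3\<close> and \<open>b = Bl\<close>, the third letter is then
  stuck between two blue ones. A flagged \<open>Le\<close> end is only served by
  \<open>Ce, Le, Bl\<close>. An unflagged one forces a first letter \<open>Bl\<close>, and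
  \<open>n = 4\<close> is excluded because a flagged \<open>Ce\<close> at the other end would again
  trap a letter between two blue ones.\<close>

fun edge_ok :: "nat \<Rightarrow> letter \<Rightarrow> bool \<Rightarrow> letter \<Rightarrow> bool" where
  "edge_ok n Bl d b \<longleftrightarrow> (b = Bl \<longrightarrow> 2 \<le> n)"
| "edge_ok n Ce d b \<longleftrightarrow> (d \<longrightarrow> (if n = 1 then b = Bl else b = Bl \<longrightarrow> n \<noteq> 3))"
| "edge_ok n Le d b \<longleftrightarrow>
     (if d then b = Bl \<and> n = 3
      else if n = 1 then b \<noteq> Bl
      else b = Bl \<and> n = 3 \<or> b = Ce \<and> n \<noteq> 4)"

definition word_for :: "nat \<Rightarrow> letter \<Rightarrow> bool \<Rightarrow> letter \<Rightarrow> bool \<Rightarrow> letter list \<Rightarrow> bool" where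
  "word_for n a d b e w \<longleftrightarrow>
     length w = n \<and> ok_word (a # w @ [b]) \<and> end_ok n a d (hd w) \<and> end_ok n b e (last w)"

lemma word_for_rev: "word_for n a d b e w \<Longrightarrow> word_for n b e a d (rev w)"
  using ok_word_rev[of "a # w @ [b]"]
  by (auto simp: word_for_def hd_rev last_rev)

text \<open>Beginning with \<open>Le\<close> serves the \<open>Ce\<close> end whether or not it is
  flagged; the rest is a red-red word ending in \<open>Bl\<close>, which suits an unflagged red end.
  For \<open>n = 4\<close> the rest would have the impossible length 3, but then
  \<open>b = Ce\<close> and the word may end in \<open>Le\<close>.\<close>

lemma ex_word_Ce_red:
  assumes "n \<ge> 1" "edge_ok n Ce d b" "edge_ok n b e Ce" "b \<noteq> Bl" "\<not> e"
  shows "\<exists>w. word_for n Ce d b e w"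
proof -
  consider "n = 1" | "n = 4" | "n \<ge> 2" "n \<noteq> 4"
    using assms(1) by linarith
  then show ?thesis
  proof cases
    case 1
    then show ?thesis
      using assms by (cases b) (auto simp: word_for_def intro!: exI[of _ "[Bl]"])
  next
    case 2
    then show ?thesis
      using assms by (cases b) (auto simp: word_for_def intro!: exI[of _ "[Le, Bl, Bl, Le]"])
  next
    case 3
    then have le: "n - 1 \<ge> 1" and diff: "n - 1 \<noteq> 3" by auto
    obtain w where w: "length (Bl # w) = n - 1" "last (Bl # w) = Bl"
      "\<forall>a b. a \<noteq> Bl \<longrightarrow> b \<noteq> Bl \<longrightarrow> ok_word (a # Bl # w @ [b])"
      using ex_word_red_red[OF le diff] by blast
    then show ?thesis
      using assms 3 by (cases b) (auto simp: word_for_def intro!: exI[of _ "Le # Bl # w"])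
  qed
qed

text \<open>A leaf end forces \<open>n = 3\<close>, and its flag selects the word. A
  \<open>Ce\<close> end is given \<open>Le\<close> first, except for \<open>n = 3\<close>, where
  \<open>edge_ok\<close> rules out the flag and the word may start with \<open>Bl\<close>.\<close>

lemma ex_word_red_Bl:
  assumes "n \<ge> 1" "edge_ok n a d Bl" "a \<noteq> Bl"
  shows "\<exists>w. word_for n a d Bl e w"
proof (cases "a = Le")
  case True
  then have "n = 3" using assms by (auto split: if_splits)
  then show ?thesis
    using True
    by (cases d) (auto simp: word_for_def intro: exI[of _ "[Ce, Le, Bl]"] exI[of _ "[Bl, Ce, Le]"])
next
  case False
  then have a: "a = Ce" using assms(3) by (cases a) auto
  consider "n = 1" | "n = 2" | "n = 3" | "n \<ge> 4"
    using assms(1) by linarith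
  then show ?thesis
  proof cases
    case 1 then show ?thesis using a by (auto simp: word_for_def intro!: exI[of _ "[Le]"])
  next
    case 2 then show ?thesis using a by (auto simp: word_for_def intro!: exI[of _ "[Le, Bl]"])
  next
    case 3 then show ?thesis
      using a assms by (auto simp: word_for_def intro!: exI[of _ "[Bl, Ce, Le]"])
  next
    case 4
    then have le: "n - 1 \<ge> 3" by auto
    obtain w where w: "length (Bl # w) = n - 1"
      "\<forall>a. a \<noteq> Bl \<longrightarrow> ok_word (a # Bl # w @ [Bl])"
      using ex_word_red_blue[OF le] by blast
    then show ?thesis
      using a 4 by (auto simp: word_for_def intro!: exI[of _ "Le # Bl # w"])
  qed
qed

lemma ex_word_Bl_Bl:
  assumes "n \<ge> 2"
  shows "\<exists>w. word_for n Bl d Bl e w"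
proof -
  consider "n = 2" | "n = 3" | "n = 4" | "n \<ge> 5"
    using assms(1) by linarith
  then show ?thesis
  proof cases
    case 1 then show ?thesis by (auto simp: word_for_def intro!: exI[of _ "[Ce, Le]"])
  next
    case 2 then show ?thesis by (auto simp: word_for_def intro!: exI[of _ "[Le, Ce, Le]"])
  next
    case 3 then show ?thesis by (auto simp: word_for_def intro!: exI[of _ "[Bl, Le, Ce, Le]"])
  next
    case 4
    then have le: "n - 2 \<ge> 3" by auto
    obtain w where w: "length (Bl # w) = n - 2"
      "\<forall>a. a \<noteq> Bl \<longrightarrow> ok_word (a # Bl # w @ [Bl])"
      using ex_word_red_blue[OF le] by blast
    then show ?thesis
      using 4 by (auto simp: word_for_def intro!: exI[of _ "Ce # Le # Bl # w"])
  qed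
qed

lemma ex_word:
  assumes n: "n \<ge> 1" and ab: "edge_ok n a d b" and ba: "edge_ok n b e a"
    and both: "d \<Longrightarrow> e \<Longrightarrow> a = Ce \<Longrightarrow> b = Ce \<Longrightarrow> n = 4"
  shows "\<exists>w. word_for n a d b e w"
proof -
  consider "a = Bl" "b = Bl" | "a \<noteq> Bl" "b = Bl" | "a = Bl" "b \<noteq> Bl"
    | "a = Ce" "b = Ce" "d" "e" | "a = Ce" "b \<noteq> Bl" "\<not> e" | "b = Ce" "a \<noteq> Bl" "\<not> d"
    | "a = Ce" "b = Le" "e" | "a = Le" "b = Ce" "d" | "a = Le" "b = Le"
    by (cases a; cases b) auto
  then show ?thesis
  proof cases
    case 1 then show ?thesis using ab ex_word_Bl_Bl by auto
  next
    case 2 then show ?thesis using n ab ex_word_red_Bl by blast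
  next
    case 3 then show ?thesis using n ba ex_word_red_Bl word_for_rev by blast
  next
    case 4 then show ?thesis using both
      by (auto simp: word_for_def intro!: exI[of _ "[Le, Bl, Bl, Le]"])
  next
    case 5 then show ?thesis using n ab ba ex_word_Ce_red by blast
  next
    case 6 then show ?thesis using n ab ba ex_word_Ce_red word_for_rev by blast
  next
    case 9 then show ?thesis using n ab ba
      by (auto simp: word_for_def split: if_splits intro!: exI[of _ "[Bl]"])
  \<comment> \<open>In the remaining cases a flagged \<open>Le\<close> end faces a red end, which
    \<open>edge_ok\<close> forbids.\<close>
  qed (use ab ba in auto)
qed

subsection \<open>Choosing incident edges injectively\<close>

text \<open>The start of a longest path has a second neighbour, which must lie on the path.\<close>

lemma ex_path_back_edge:
  assumes "finite Y" "Y \<noteq> {}" and sym: "symp R" and irr: "irreflp R"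
    and deg: "\<And>u. u \<in> Y \<Longrightarrow> \<exists>v\<in>Y. \<exists>w\<in>Y. v \<noteq> w \<and> R u v \<and> R u w"
  shows "\<exists>xs j. distinct xs \<and> set xs \<subseteq> Y \<and> successively R xs \<and> 2 \<le> j \<and> j < length xs \<and> R (xs ! j) (xs ! 0)"
proof -
  define \<P> where "\<P> = {xs. distinct xs \<and> set xs \<subseteq> Y \<and> successively R xs}"
  have "finite \<P>"
    using finite_subset_distinct[OF \<open>finite Y\<close>] by (rule rev_finite_subset) (auto simp: \<P>_def)
  obtain y where "y \<in> Y" using \<open>Y \<noteq> {}\<close> by auto
  then have y: "[y] \<in> \<P>" by (auto simp: \<P>_def)
  with \<open>finite \<P>\<close> obtain xs where xs: "xs \<in> \<P>" and max: "\<And>ys. ys \<in> \<P> \<Longrightarrow> length ys \<le> length xs"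
    using Max_in[of "length ` \<P>"] Max_ge[of "length ` \<P>"] by fastforce
  from max[OF y] obtain x zs where xs_eq: "xs = x # zs" by (cases xs) auto
  then have x: "x \<in> Y" and P: "distinct (x # zs)" "set zs \<subseteq> Y" "successively R (x # zs)"
    using xs by (auto simp: \<P>_def)
  obtain v where v: "v \<in> Y" "R x v" "zs \<noteq> [] \<longrightarrow> v \<noteq> hd zs"
    using deg[OF x] by metis
  have "v \<in> set xs"
  proof (rule ccontr)
    assume "v \<notin> set xs"
    then have "v # xs \<in> \<P>"
      using xs v sym by (auto simp: \<P>_def xs_eq dest: sympD)
    then show False using max[of "v # xs"] by simp
  qed
  moreover have "v \<noteq> x" using v irr by (auto dest: irreflpD)
  ultimately obtain i where i: "i < length zs" "v = zs ! i"
    by (auto simp: xs_eq in_set_conv_nth)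
  then have "i \<noteq> 0" using v(3) by (cases zs; cases i) auto
  then show ?thesis
    using xs i v sym by (intro exI[of _ xs] exI[of _ "Suc i"]) (auto simp: xs_eq \<P>_def dest: sympD)
qed

text \<open>The back edge closes an initial part of the path to a cycle. Each vertex points to its
  successor; since \<open>2 \<le> j\<close>, the cycle has at least three vertices, so no edge is
  chosen from both ends.\<close>

lemma cyclic_pointers:
  assumes "finite Y" "Y \<noteq> {}" and sym: "symp R" and irr: "irreflp R"
    and deg: "\<And>u. u \<in> Y \<Longrightarrow> \<exists>v\<in>Y. \<exists>w\<in>Y. v \<noteq> w \<and> R u v \<and> R u w"
  shows "\<exists>Z f. Z \<noteq> {} \<and> Z \<subseteq> Y \<and> (\<forall>u\<in>Z. f u \<in> Z \<and> R u (f u) \<and> f (f u) \<noteq> u)"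
proof -
  obtain xs j where xs: "distinct xs" "set xs \<subseteq> Y" "successively R xs" "2 \<le> j" "j < length xs"
    and closing: "R (xs ! j) (xs ! 0)"
    using ex_path_back_edge[OF assms] by blast
  define Z where "Z = (!) xs ` {..j}"
  define nxt where "nxt i = (if i = j then 0 else Suc i)" for i
  define f where "f = (\<lambda>u. xs ! nxt (the_inv_into {..j} ((!) xs) u))"
  have inj: "inj_on ((!) xs) {..j}"
    using xs by (auto simp: inj_on_def nth_eq_iff_index_eq)
  have f: "f (xs ! i) = xs ! nxt i" if "i \<le> j" for i
    using that the_inv_into_f_f[OF inj] by (simp add: f_def)
  have "f u \<in> Z \<and> R u (f u) \<and> f (f u) \<noteq> u" if "u \<in> Z" for u
  proof -
    obtain i where i: "i \<le> j" "u = xs ! i" using \<open>u \<in> Z\<close> by (auto simp: Z_def)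
    have n: "nxt i \<le> j" "nxt (nxt i) \<le> j" "nxt (nxt i) \<noteq> i"
      using i xs by (auto simp: nxt_def)
    have "R (xs ! i) (xs ! nxt i)"
      using closing xs i successively_nth[OF xs(3), of i] by (auto simp: nxt_def)
    then show ?thesis
      using n i xs inj by (auto simp: f Z_def nth_eq_iff_index_eq)
  qed
  then show ?thesis
    using xs by (intro exI[of _ Z] exI[of _ f]) (auto simp: Z_def)
qed

text \<open>
  A vertex with a neighbour in \<open>P\<close> can point there and join \<open>P\<close>. If there is none, all vertices
  outside \<open>P\<close> have two neighbours outside \<open>P\<close>, hence there is a cycle, whose vertices can join \<open>P\<close>.
\<close>

lemma ex_pointers:
  assumes "finite X" and sym: "symp R" and irr: "irreflp R" and "P \<subseteq> X"
    and "\<And>u. u \<in> X - P \<Longrightarrow> \<exists>v\<in>X. \<exists>w\<in>X. v \<noteq> w \<and> R u v \<and> R u w"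
  shows "\<exists>f. \<forall>u\<in>X - P. f u \<in> X \<and> R u (f u) \<and> (f u \<in> X - P \<longrightarrow> f (f u) \<noteq> u)"
  using assms(4,5)
proof (induction "card (X - P)" arbitrary: P rule: less_induct)
  case less
  have extend: ?case if Z: "Z \<noteq> {}" "Z \<subseteq> X - P"
    and g: "\<And>u. u \<in> Z \<Longrightarrow> g u \<in> Z \<union> P \<and> R u (g u) \<and> g (g u) \<noteq> u \<or> g u \<in> P \<and> R u (g u)" for Z g
  proof -
    have "X - (P \<union> Z) \<subset> X - P" using Z by auto
    then have "card (X - (P \<union> Z)) < card (X - P)"
      using \<open>finite X\<close> by (intro psubset_card_mono) auto
    then obtain f where f: "\<forall>u\<in>X - (P \<union> Z). f u \<in> X \<and> R u (f u) \<and> (f u \<in> X - (P \<union> Z) \<longrightarrow> f (f u) \<noteq> u)"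
      using less.hyps[of "P \<union> Z"] less.prems Z by auto
    define h where "h u = (if u \<in> Z then g u else f u)" for u
    have "h u \<in> X \<and> R u (h u) \<and> (h u \<in> X - P \<longrightarrow> h (h u) \<noteq> u)" if u: "u \<in> X - P" for u
    proof (cases "u \<in> Z")
      case True
      then show ?thesis using g[of u] Z less.prems(1) by (auto simp: h_def)
    next
      case False
      \<comment> \<open>Pointers from outside may enter \<open>Z\<close>, but those of
        \<open>Z\<close> stay in \<open>Z \<union> P\<close>, so the two families never choose the
        same edge.\<close>
      have "g v \<noteq> u" if "v \<in> Z" for v using g[of v] that False u by auto
      then show ?thesis using False f u by (auto simp: h_def)
    qed
    then show ?thesis by blast
  qed
  consider "X - P = {}" | u p where "u \<in> X - P" "p \<in> P" "R u p"
    | "X - P \<noteq> {}" "\<And>u p. u \<in> X - P \<Longrightarrow> p \<in> P \<Longrightarrow> \<not> R u p"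
    by blast
  then show ?case
  proof cases
    case 1 then show ?thesis by blast
  next
    case (2 u p)
    then show ?thesis using extend[of "{u}" "\<lambda>_. p"] by auto
  next
    case 3
    have "\<exists>v\<in>X - P. \<exists>w\<in>X - P. v \<noteq> w \<and> R u v \<and> R u w" if "u \<in> X - P" for u
      using less.prems(2)[OF that] 3(2)[OF that] by blast
    then obtain Z f where "Z \<noteq> {}" "Z \<subseteq> X - P" "\<forall>u\<in>Z. f u \<in> Z \<and> R u (f u) \<and> f (f u) \<noteq> u"
      using cyclic_pointers[of "X - P" R] \<open>finite X\<close> sym irr 3(1) by (metis finite_Diff)
    then show ?thesis using extend[of Z f] by blast
  qed
qed

text \<open>The vertices of \<open>Q\<close> can do without a pointer, but those left without one
  will become leaves, and no long edge may join two leaves. Giving pointers to as many vertices as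
  possible ensures this.\<close>

lemma ex_maximal_pointers:
  assumes "finite X" and sym: "symp R" and irr: "irreflp R" and "P \<subseteq> X" "Q \<subseteq> X"
    and "\<And>u. u \<in> X - P - Q \<Longrightarrow> \<exists>v\<in>X. \<exists>w\<in>X. v \<noteq> w \<and> R u v \<and> R u w"
  shows "\<exists>D f. X - P - Q \<subseteq> D \<and> D \<subseteq> X - P \<and>
    (\<forall>u\<in>D. f u \<in> X \<and> R u (f u) \<and> (f u \<in> D \<longrightarrow> f (f u) \<noteq> u)) \<and>
    (\<forall>u\<in>X - P - D. \<forall>v\<in>X - P - D. \<not> R u v)"
proof -
  define ptr where "ptr D f \<longleftrightarrow> X - P - Q \<subseteq> D \<and> D \<subseteq> X - P \<and>
    (\<forall>u\<in>D. f u \<in> X \<and> R u (f u) \<and> (f u \<in> D \<longrightarrow> f (f u) \<noteq> u))" for D f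
  define \<D> where "\<D> = {D. \<exists>f. ptr D f}"
  have "\<D> \<subseteq> Pow X" by (auto simp: \<D>_def ptr_def)
  then have "finite \<D>" using \<open>finite X\<close> by (meson finite_Pow_iff finite_subset)
  have "\<exists>f. \<forall>u\<in>X - (P \<union> Q). f u \<in> X \<and> R u (f u) \<and> (f u \<in> X - (P \<union> Q) \<longrightarrow> f (f u) \<noteq> u)"
    using assms by (intro ex_pointers) auto
  moreover have "X - (P \<union> Q) = X - P - Q" by blast
  ultimately have "X - P - Q \<in> \<D>" by (auto simp: \<D>_def ptr_def)
  then obtain D where D: "D \<in> \<D>" and max: "\<And>D'. D' \<in> \<D> \<Longrightarrow> D \<subseteq> D' \<Longrightarrow> D = D'"
    using finite_has_maximal[OF \<open>finite \<D>\<close>] by blast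
  then obtain f where f: "ptr D f" by (auto simp: \<D>_def)
  have "\<not> R u v" if uv: "u \<in> X - P - D" "v \<in> X - P - D" for u v
  proof
    assume "R u v"
    then have "u \<noteq> v" using irr by (auto dest: irreflpD)
    \<comment> \<open>Letting \<open>u\<close> point to \<open>v\<close> is harmless:
      \<open>v\<close> has no pointer, so it neither points back nor points to
      \<open>u\<close>.\<close>
    then have "ptr (insert u D) (f(u := v))"
      using f uv \<open>R u v\<close> by (auto simp: ptr_def)
    then have "insert u D \<in> \<D>" by (auto simp: \<D>_def)
    then show False using max uv by blast
  qed
  then show ?thesis using f unfolding ptr_def by blast
qed

subsection \<open>Letters for the vertices of the original graph\<close>

text \<open>Here \<open>k\<close> counts subdivision vertices and \<open>m u\<close> is the far end
  of the edge on which a red vertex \<open>u\<close> relies. The conclusions are what is needed to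
  fill every edge with a word and to glue the words together.\<close>

lemma ex_vertex_letters:
  fixes E :: "'a rel" and k :: "'a \<times> 'a \<Rightarrow> nat"
  assumes "finite V" and EV: "E \<subseteq> V \<times> V"
    and symE: "\<And>u v. (u, v) \<in> E \<Longrightarrow> (v, u) \<in> E" and irr: "\<And>u. (u, u) \<notin> E"
    and symk: "\<And>u v. (u, v) \<in> E \<Longrightarrow> k (v, u) = k (u, v)"
    and k1: "\<And>u v. (u, v) \<in> E \<Longrightarrow> 1 \<le> k (u, v)"
  obtains s m where "\<And>u v w. s u = Bl \<Longrightarrow> (u, v) \<in> E \<Longrightarrow> (u, w) \<in> E \<Longrightarrow>
      2 \<le> k (u, v) \<Longrightarrow> 2 \<le> k (u, w) \<Longrightarrow> v = w"
    and "\<And>u. u \<in> V \<Longrightarrow> s u \<noteq> Bl \<Longrightarrow> (u, m u) \<in> E"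
    and "\<And>u v. (u, v) \<in> E \<Longrightarrow> edge_ok (k (u, v)) (s u) (m u = v) (s v)"
    and "\<And>u v. (u, v) \<in> E \<Longrightarrow> s u = Ce \<Longrightarrow> s v = Ce \<Longrightarrow> m u = v \<Longrightarrow> m v = u \<Longrightarrow> k (u, v) = 4"
proof -
  define long where "long u v \<longleftrightarrow> (u, v) \<in> E \<and> 2 \<le> k (u, v)" for u v
  define short where "short u v \<longleftrightarrow> (u, v) \<in> E \<and> k (u, v) = 1" for u v
  have long_sym: "symp long" and long_irr: "irreflp long"
    using symE symk irr by (auto simp: long_def symp_def irreflp_def)
  have short_sym: "short u v \<Longrightarrow> short v u" for u v
    using symE symk by (auto simp: short_def)
  have E_cases: "short u v \<or> long u v" if "(u, v) \<in> E" for u v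
    using k1[OF that] that by (auto simp: short_def long_def)

  define good where "good = {u \<in> V. \<forall>v w. long u v \<longrightarrow> long u w \<longrightarrow> v = w}"
  define indep where "indep = {A. A \<subseteq> good \<and> (\<forall>u\<in>A. \<forall>v\<in>A. \<not> short u v)}"
  have "indep \<subseteq> Pow V" by (auto simp: indep_def good_def)
  then have "finite indep" using \<open>finite V\<close> by (meson finite_Pow_iff finite_subset)
  moreover have "{} \<in> indep" by (auto simp: indep_def)
  ultimately obtain A where A: "A \<in> indep" and max: "\<And>A'. A' \<in> indep \<Longrightarrow> A \<subseteq> A' \<Longrightarrow> A = A'"
    using finite_has_maximal[of indep] by blast
  have A_good: "\<And>u v w. u \<in> A \<Longrightarrow> long u v \<Longrightarrow> long u w \<Longrightarrow> v = w"
    and A_indep: "\<And>u v. u \<in> A \<Longrightarrow> v \<in> A \<Longrightarrow> \<not> short u v"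
    using A by (auto simp: indep_def good_def)
  have dom: "\<exists>v\<in>A. short u v" if "u \<in> good - A" for u
  proof (rule ccontr)
    assume "\<not> (\<exists>v\<in>A. short u v)"
    moreover have "\<not> short u u" using irr by (auto simp: short_def)
    ultimately have "insert u A \<in> indep"
      using that A short_sym by (auto simp: indep_def)
    then show False using max that by blast
  qed

  define sat where "sat = {u \<in> V - A. \<exists>v\<in>A. short u v}"
  define X where "X = V - A - sat"
  have X_short: "\<not> short u v" if "u \<in> X" "v \<in> A" for u v
    using that by (auto simp: X_def sat_def)
  have X_bad: "\<exists>v w. v \<noteq> w \<and> long u v \<and> long u w" if "u \<in> X" for u
    using that dom[of u] by (auto simp: X_def sat_def good_def)
  \<comment> \<open>The long edges from which a vertex of \<open>X\<close> can get a red leaf neighbour without asking anything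
    of another vertex of \<open>X\<close>. An edge with four internal vertices serves both of its ends
    (\<open>Le, Bl, Bl, Le\<close>).\<close>
  define nice where "nice u v \<longleftrightarrow> long u v \<and> (v \<notin> X \<union> A \<or> k (u, v) = 4 \<or> v \<in> A \<and> k (u, v) \<noteq> 3)" for u v
  define P where "P = {u \<in> X. \<exists>v. nice u v}"
  define Q where "Q = {u \<in> X. \<exists>v\<in>A. long u v \<and> k (u, v) = 3}"
  have "\<exists>v\<in>X. \<exists>w\<in>X. v \<noteq> w \<and> long u v \<and> long u w" if "u \<in> X - P - Q" for u
  proof -
    \<comment> \<open>A long edge that is not nice ends in \<open>X\<close>, or in \<open>A\<close>
      with three subdivision vertices; the latter would put \<open>u\<close> into
      \<open>Q\<close>.\<close>
    have "v \<in> X" if "long u v" for v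
      using that \<open>u \<in> X - P - Q\<close> by (auto simp: P_def Q_def nice_def)
    then show ?thesis using X_bad[of u] that by blast
  qed
  moreover have sub: "finite X" "P \<subseteq> X" "Q \<subseteq> X"
    using \<open>finite V\<close> by (auto simp: X_def P_def Q_def)
  ultimately obtain D f where D: "X - P - Q \<subseteq> D" "D \<subseteq> X - P"
    and f: "\<And>u. u \<in> D \<Longrightarrow> f u \<in> X \<and> long u (f u) \<and> (f u \<in> D \<longrightarrow> f (f u) \<noteq> u)"
    and left: "\<And>u v. u \<in> X - P - D \<Longrightarrow> v \<in> X - P - D \<Longrightarrow> \<not> long u v"
    using ex_maximal_pointers[OF _ long_sym long_irr, of X P Q] by metis
  \<comment> \<open>These vertices become leaves, on a path with internal letters \<open>Ce, Le, Bl\<close>.\<close>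
  define L where "L = X - P - D"
  have "\<forall>u\<in>sat. \<exists>v. v \<in> A \<and> short u v" by (auto simp: sat_def)
  then obtain m1 where m1: "\<And>u. u \<in> sat \<Longrightarrow> m1 u \<in> A \<and> short u (m1 u)"
    by (auto dest!: bchoice)
  have "\<forall>u\<in>P. \<exists>v. nice u v" by (auto simp: P_def)
  then obtain m2 where m2: "\<And>u. u \<in> P \<Longrightarrow> nice u (m2 u)"
    by (auto dest!: bchoice)
  have "\<forall>u\<in>Q. \<exists>v. v \<in> A \<and> long u v \<and> k (u, v) = 3" by (auto simp: Q_def)
  then obtain m3 where m3: "\<And>u. u \<in> Q \<Longrightarrow> m3 u \<in> A \<and> long u (m3 u) \<and> k (u, m3 u) = 3"
    by (auto dest!: bchoice)
  define s where "s u = (if u \<in> A then Bl else if u \<in> L then Le else Ce)" for u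
  \<comment> \<open>On \<open>A\<close> this is an arbitrary value; \<open>edge_ok\<close> and
    \<open>end_ok\<close> ignore the flag at a \<open>Bl\<close> end.\<close>
  define m where "m u = (if u \<in> sat then m1 u else if u \<in> P then m2 u else if u \<in> D then f u else m3 u)" for u
  have s_Bl: "s u = Bl \<longleftrightarrow> u \<in> A" and s_Le: "s u = Le \<longleftrightarrow> u \<in> L"
    and s_Ce: "s u = Ce \<longleftrightarrow> u \<notin> A \<and> u \<notin> L" for u
    by (auto simp: s_def L_def X_def)
  have LQ: "L \<subseteq> Q" using D by (auto simp: L_def)
  have m_L: "m u \<in> A \<and> long u (m u) \<and> k (u, m u) = 3" if "u \<in> L" for u
    using that m3[of u] LQ by (auto simp: m_def L_def X_def)
  have m_Ce: "u \<in> sat \<and> m u \<in> A \<and> short u (m u) \<or> u \<in> P \<and> nice u (m u) \<or>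
      u \<in> D \<and> m u \<in> X \<and> long u (m u) \<and> (m u \<in> D \<longrightarrow> m (m u) \<noteq> u)"
    if "u \<in> V" "u \<notin> A" "u \<notin> L" for u
    using that m1[of u] m2[of u] f[of u] D
    by (auto simp: m_def L_def X_def P_def)

  have "(u, m u) \<in> E" if "u \<in> V" "s u \<noteq> Bl" for u
    using that m_L[of u] m_Ce[of u] by (auto simp: s_Bl long_def short_def nice_def)
  moreover have "edge_ok (k (u, v)) (s u) (m u = v) (s v)" if uv: "(u, v) \<in> E" for u v
  proof (cases "s u")
    case Bl
    then have "s v = Bl \<Longrightarrow> 2 \<le> k (u, v)"
      using A_indep[of u v] E_cases[OF uv] by (auto simp: s_Bl long_def)
    then show ?thesis using Bl by simp
  next
    case Ce
    then have "u \<notin> A" "u \<notin> L" by (auto simp: s_Ce)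
    moreover have "u \<in> V" using uv EV by auto
    ultimately have "m u = v \<Longrightarrow> k (u, v) = 1 \<and> v \<in> A \<or> 2 \<le> k (u, v) \<and> (v \<in> A \<longrightarrow> k (u, v) \<noteq> 3)"
      using m_Ce[of u] by (auto simp: X_def nice_def long_def short_def)
    then show ?thesis using Ce s_Bl[of v] by auto
  next
    case Le
    then have u: "u \<in> L" "u \<in> X" "u \<notin> P" by (auto simp: s_Le L_def)
    then have not_nice: "\<not> nice u v" by (auto simp: P_def)
    have not_long: "v \<in> L \<Longrightarrow> \<not> long u v" using left u by (auto simp: L_def)
    consider "v \<in> A" "s v = Bl" | "v \<in> L" "s v = Le" | "v \<notin> A" "s v = Ce"
      using s_Bl[of v] s_Le[of v] s_Ce[of v] by (cases "s v") auto
    then show ?thesis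
    proof cases
      case 1
      then have "long u v" using X_short[of u v] u E_cases[OF uv] by auto
      then show ?thesis using 1 Le not_nice by (auto simp: nice_def long_def)
    next
      case 2
      then have "v \<notin> A" "k (u, v) = 1"
        using not_long E_cases[OF uv] by (auto simp: L_def X_def short_def)
      then show ?thesis using 2 Le m_L[OF u(1)] by auto
    next
      case 3
      \<comment> \<open>Four subdivision vertices would make the edge nice and put \<open>u\<close>
        into \<open>P\<close>.\<close>
      then show ?thesis using Le m_L[OF u(1)] not_nice uv k1[OF uv]
        by (auto simp: nice_def long_def)
    qed
  qed
  moreover have "k (u, v) = 4" if uv: "(u, v) \<in> E" and c: "s u = Ce" "s v = Ce" and m: "m u = v" "m v = u" for u v
  proof (rule ccontr)
    assume "k (u, v) \<noteq> 4"
    moreover have "u \<in> V" "v \<in> V" "k (v, u) = k (u, v)" using uv EV symk by auto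
    moreover have "u \<notin> A" "v \<notin> A" "u \<notin> L" "v \<notin> L" using c by (auto simp: s_Ce)
    \<comment> \<open>A nice edge chosen in \<open>P\<close> then leaves \<open>X\<close>, and a red
      vertex outside \<open>X\<close> relies on an edge to \<open>A\<close>, never on one back to
      \<open>X\<close>. Two vertices of \<open>D\<close> do not point at each other.\<close>
    ultimately show False
      using m_Ce[of u] m_Ce[of v] m D(2) sub(2) by (auto simp: nice_def X_def)
  qed
  moreover have "v = w"
    if "s u = Bl" "(u, v) \<in> E" "(u, w) \<in> E" "2 \<le> k (u, v)" "2 \<le> k (u, w)" for u v w
    using that A_good by (auto simp: s_Bl long_def)
  ultimately show thesis by (intro that[of s m]) blast+
qed

subsection \<open>Colouring the subdivision\<close>

lemma set_vwalk_arcs: "set (vwalk_arcs p) = {(p ! i, p ! Suc i) | i. Suc i < length p}"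
proof (induction p rule: vwalk_arcs.induct)
  case (3 x y xs)
  have "{((x # y # xs) ! i, (x # y # xs) ! Suc i) | i. Suc i < length (x # y # xs)} =
      insert (x, y) {((y # xs) ! i, (y # xs) ! Suc i) | i. Suc i < length (y # xs)}"
    (is "?l = ?r")
  proof
    show "?l \<subseteq> ?r"
    proof
      fix e assume "e \<in> ?l"
      then obtain i where "e = ((x # y # xs) ! i, (x # y # xs) ! Suc i)" "i < Suc (length xs)" by auto
      then show "e \<in> ?r" by (cases i) auto
    qed
    show "?r \<subseteq> ?l" by force
  qed
  then show ?case using 3 by simp
qed auto

text \<open>The two inner vertices of a red path with three edges have two red neighbours each, so
  neither is a leaf; then they are adjacent centres, which is impossible.\<close>

lemma crumby_coloring_of_letters:
  assumes fin: "finite (parcs S)" and SV: "parcs S \<subseteq> pverts S \<times> pverts S"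
    and sym: "\<And>x y. (x, y) \<in> parcs S \<Longrightarrow> (y, x) \<in> parcs S"
    and Bl: "\<And>x y z. (x, y) \<in> parcs S \<Longrightarrow> (x, z) \<in> parcs S \<Longrightarrow>
      l x = Bl \<Longrightarrow> l y = Bl \<Longrightarrow> l z = Bl \<Longrightarrow> y = z"
    and red: "\<And>x. x \<in> pverts S \<Longrightarrow> l x \<noteq> Bl \<Longrightarrow> \<exists>y. (x, y) \<in> parcs S \<and> l y \<noteq> Bl"
    and Ce: "\<And>x y. (x, y) \<in> parcs S \<Longrightarrow> l x = Ce \<Longrightarrow> l y \<noteq> Ce"
    and Le: "\<And>x y z. (x, y) \<in> parcs S \<Longrightarrow> (x, z) \<in> parcs S \<Longrightarrow>
      l x = Le \<Longrightarrow> l y \<noteq> Bl \<Longrightarrow> l z \<noteq> Bl \<Longrightarrow> y = z"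
  shows "crumby_coloring S (\<lambda>x. if l x = Bl then Blue else Red)"
proof -
  define c where "c x = (if l x = Bl then Blue else Red)" for x
  define R where "R = with_proj S \<restriction> color_class S c Red"
  define B where "B = with_proj S \<restriction> color_class S c Blue"
  have R: "verts R = {x \<in> pverts S. l x \<noteq> Bl}" "arcs R = {(x, y) \<in> parcs S. l x \<noteq> Bl \<and> l y \<noteq> Bl}"
    "tail R = fst" "head R = snd"
    using SV by (auto simp: R_def color_class_def c_def)
  have B: "verts B = {x \<in> pverts S. l x = Bl}" "arcs B = {(x, y) \<in> parcs S. l x = Bl \<and> l y = Bl}"
    "tail B = fst"
    using SV by (auto simp: B_def color_class_def c_def)
  have "finite (out_arcs B v)" "finite (out_arcs R v)" for v
    using fin by (auto simp: out_arcs_def B R intro: rev_finite_subset)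
  have "out_degree B v \<le> 1" for v
    unfolding out_degree_def One_nat_def card_le_Suc0_iff_eq[OF \<open>finite (out_arcs B v)\<close>]
    using Bl by (auto simp: out_arcs_def B)
  moreover have "1 \<le> out_degree R v" if "v \<in> verts R" for v
  proof -
    have "v \<in> pverts S" "l v \<noteq> Bl" using that by (auto simp: R)
    then obtain y where "(v, y) \<in> parcs S" "l y \<noteq> Bl" "l v \<noteq> Bl" using red by blast
    then have "(v, y) \<in> out_arcs R v" by (auto simp: out_arcs_def R)
    then show ?thesis
      using \<open>finite (out_arcs R v)\<close> by (auto simp: out_degree_def Suc_le_eq card_gt_0_iff)
  qed
  moreover have False if path: "pre_digraph.apath R u p v" and "length p = 3" for u p v
  proof -
    obtain e1 e2 e3 where p: "p = [e1, e2, e3]"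
      using \<open>length p = 3\<close> by (auto simp: numeral_3_eq_3 length_Suc_conv)
    obtain x0 x1 x2 x3 where x: "(x0, x1) \<in> arcs R" "(x1, x2) \<in> arcs R" "(x2, x3) \<in> arcs R"
      and ne: "x0 \<noteq> x2" "x1 \<noteq> x3"
      using path
      by (cases e1; cases e2; cases e3)
         (auto simp: p pre_digraph.apath_def pre_digraph.awalk_def pre_digraph.cas.simps pre_digraph.awalk_verts.simps R(3,4))
    have "l x1 \<noteq> Le" using Le[of x1 x0 x2] sym x ne by (auto simp: R)
    moreover have "l x2 \<noteq> Le" using Le[of x2 x1 x3] sym x ne by (auto simp: R)
    ultimately show False using Ce[of x1 x2] x by (cases "l x1"; cases "l x2") (auto simp: R)
  qed
  ultimately show ?thesis
    unfolding crumby_coloring_def Let_def c_def[symmetric] R_def[symmetric] B_def[symmetric] by blast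
qed

section \<open>Neighbourhoods in the subdivision and gluing of words\<close>

locale subdivided_graph = pair_graph G for G :: "'a pair_pre_digraph" +
  fixes S :: "'a pair_pre_digraph" and \<iota> :: "'a \<times> 'a \<Rightarrow> 'a list"
  assumes \<iota>_swap: "(u, v) \<in> parcs G \<Longrightarrow> \<iota> (v, u) = rev (\<iota> (u, v))"
    and \<iota>_nonempty: "e \<in> parcs G \<Longrightarrow> \<iota> e \<noteq> []"
    and distinct_\<iota>: "e \<in> parcs G \<Longrightarrow> distinct (\<iota> e)"
    and \<iota>_new: "e \<in> parcs G \<Longrightarrow> set (\<iota> e) \<inter> pverts G = {}"
    and \<iota>_disjoint: "(u, v) \<in> parcs G \<Longrightarrow> (x, y) \<in> parcs G \<Longrightarrow> {u, v} \<noteq> {x, y} \<Longrightarrow>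
      set (\<iota> (u, v)) \<inter> set (\<iota> (x, y)) = {}"
    and pverts_S: "pverts S = pverts G \<union> (\<Union>e \<in> parcs G. set (\<iota> e))"
    and parcs_S: "parcs S = (\<Union>(u, v) \<in> parcs G. set (vwalk_arcs (u # \<iota> (u, v) @ [v])))"
begin

text \<open>Entry \<open>i\<close> of \<open>\<iota> e\<close> is entry \<open>Suc i\<close> here,
  so its neighbours on the path are the entries \<open>i\<close> and
  \<open>Suc (Suc i)\<close>.\<close>

definition epath :: "'a \<times> 'a \<Rightarrow> 'a list" where
  "epath e = fst e # \<iota> e @ [snd e]"

lemma parc_swap: "(u, v) \<in> parcs G \<Longrightarrow> (v, u) \<in> parcs G"
  using pair_sym_arcs by (auto simp: symmetric_def dest: symD)

lemma no_loop: "(u, u) \<notin> parcs G"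
  using pair_no_loops by fastforce

lemma length_epath: "length (epath e) = Suc (Suc (length (\<iota> e)))"
  by (simp add: epath_def)

lemma epath_swap: "(u, v) \<in> parcs G \<Longrightarrow> epath (v, u) = rev (epath (u, v))"
  using \<iota>_swap by (simp add: epath_def)

lemma distinct_epath: "e \<in> parcs G \<Longrightarrow> distinct (epath e)"
  using distinct_\<iota>[of e] \<iota>_new[of e] arc_fst_in_verts[of e] arc_snd_in_verts[of e] pair_no_loops[of e]
  by (auto simp: epath_def)

lemma mem_parcs_S:
  "(x, y) \<in> parcs S \<longleftrightarrow>
    (\<exists>e\<in>parcs G. \<exists>i. Suc i < length (epath e) \<and> x = epath e ! i \<and> y = epath e ! Suc i)"
  unfolding parcs_S set_vwalk_arcs epath_def by fastforce

lemma parcs_S_I: "e \<in> parcs G \<Longrightarrow> Suc i < length (epath e) \<Longrightarrow> (epath e ! i, epath e ! Suc i) \<in> parcs S"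
  by (auto simp: mem_parcs_S)

lemma parcs_S_swap:
  assumes "(x, y) \<in> parcs S"
  shows "(y, x) \<in> parcs S"
proof -
  obtain u v i where e: "(u, v) \<in> parcs G" and i: "Suc i < length (epath (u, v))"
    and xy: "x = epath (u, v) ! i" "y = epath (u, v) ! Suc i"
    using assms by (auto simp: mem_parcs_S)
  let ?j = "length (epath (u, v)) - Suc (Suc i)"
  have "y = epath (v, u) ! ?j" "x = epath (v, u) ! Suc ?j" "Suc ?j < length (epath (v, u))"
    using i by (auto simp: epath_swap[OF e] xy rev_nth Suc_diff_Suc)
  then show ?thesis using parc_swap[OF e] by (auto simp: mem_parcs_S)
qed

lemma finite_parcs_S: "finite (parcs S)"
  unfolding parcs_S using pair_finite_arcs by auto

lemma set_epath_subset: "e \<in> parcs G \<Longrightarrow> set (epath e) \<subseteq> pverts S"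
  using arc_fst_in_verts[of e] arc_snd_in_verts[of e] by (auto simp: epath_def pverts_S)

lemma parcs_S_subset: "parcs S \<subseteq> pverts S \<times> pverts S"
  using set_epath_subset by (fastforce simp: mem_parcs_S)

lemma nth_epath_cases:
  assumes "i < length (epath e)"
  obtains "i = 0" "epath e ! i = fst e" | "i = Suc (length (\<iota> e))" "epath e ! i = snd e"
    | j where "i = Suc j" "j < length (\<iota> e)" "epath e ! i = \<iota> e ! j"
proof (cases i)
  case 0 then show ?thesis using that(1) by (simp add: epath_def)
next
  case (Suc j)
  then show ?thesis
    using assms that(2) that(3)[of j] by (cases "j < length (\<iota> e)") (auto simp: epath_def nth_append less_Suc_eq)
qed

lemma same_edge:
  assumes "e \<in> parcs G" "e' \<in> parcs G" "x \<in> set (\<iota> e)" "x \<in> set (\<iota> e')"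
  shows "e' = e \<or> e' = prod.swap e"
  using assms \<iota>_disjoint[of "fst e" "snd e" "fst e'" "snd e'"]
  by (cases e; cases e') (auto simp: doubleton_eq_iff)

lemma old_neighbour:
  assumes "u \<in> pverts G" "(u, y) \<in> parcs S"
  obtains v where "(u, v) \<in> parcs G" "y = hd (\<iota> (u, v))"
proof -
  obtain e i where e: "e \<in> parcs G" and i: "Suc i < length (epath e)"
    and xy: "u = epath e ! i" "y = epath e ! Suc i"
    using assms by (auto simp: mem_parcs_S)
  have "i = 0"
  proof (rule nth_epath_cases[of i e])
    fix j assume "j < length (\<iota> e)" "epath e ! i = \<iota> e ! j"
    then show ?thesis using \<iota>_new[OF e] assms(1) xy by (metis disjoint_iff nth_mem)
  qed (use i in \<open>auto simp: length_epath\<close>)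
  then have "fst e = u" "y = hd (\<iota> e)"
    using xy \<iota>_nonempty[OF e] by (auto simp: epath_def nth_append hd_conv_nth)
  then show ?thesis using that[of "snd e"] e by auto
qed

lemma old_neighbourI:
  assumes "(u, v) \<in> parcs G"
  shows "(u, hd (\<iota> (u, v))) \<in> parcs S"
  using parcs_S_I[OF assms, of 0] \<iota>_nonempty[OF assms]
  by (auto simp: epath_def nth_append hd_conv_nth)

text \<open>Any arc at an internal vertex comes from the path of \<open>e\<close> or its reversal,
  and distinctness fixes the position on it.\<close>

lemma new_neighbour:
  assumes e: "e \<in> parcs G" and i: "i < length (\<iota> e)" and y: "(\<iota> e ! i, y) \<in> parcs S"
  shows "y = epath e ! i \<or> y = epath e ! Suc (Suc i)"
proof -
  let ?x = "\<iota> e ! i"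
  have x: "?x = epath e ! Suc i" using i by (simp add: epath_def nth_append)
  obtain e' j where e': "e' \<in> parcs G" and j: "Suc j < length (epath e')"
    and xy: "?x = epath e' ! j" "y = epath e' ! Suc j"
    using y by (auto simp: mem_parcs_S)
  have "?x \<notin> pverts G" using \<iota>_new[OF e] i by (metis disjoint_iff nth_mem)
  then have "?x \<in> set (\<iota> e')"
    using xy(1) arc_fst_in_verts[OF e'] arc_snd_in_verts[OF e'] j
    by (auto intro: nth_epath_cases[of j e'])
  then have "e' = e \<or> e' = prod.swap e"
    using same_edge[OF e e', of ?x] i by auto
  then show ?thesis
  proof
    assume "e' = e"
    then show ?thesis
      using xy j i nth_eq_iff_index_eq[OF distinct_epath[OF e], of j "Suc i"]
      by (auto simp: x length_epath)
  next
    assume swap: "e' = prod.swap e"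
    then have rev: "epath e' = rev (epath e)"
      using epath_swap[of "fst e" "snd e"] e by (cases e) auto
    have "length (epath e) - Suc j = Suc i"
      using xy(1) j i
      by (subst nth_eq_iff_index_eq[OF distinct_epath[OF e], symmetric])
         (simp_all add: x length_epath rev rev_nth)
    then have "j = length (\<iota> e) - i" using j by (simp add: rev length_epath)
    then show ?thesis using xy(2) i j by (auto simp: rev rev_nth length_epath)
  qed
qed

text \<open>Both arcs of an edge must receive one word read in two directions. An injective
  numbering of the vertices selects the arc whose word is chosen freely.\<close>

lemma ex_word_labelling:
  assumes "\<And>u v. (u, v) \<in> parcs G \<Longrightarrow> \<exists>w. good u v w"
    and "\<And>u v w. (u, v) \<in> parcs G \<Longrightarrow> good u v w \<Longrightarrow> good v u (rev w)"
  shows "\<exists>g. \<forall>u v. (u, v) \<in> parcs G \<longrightarrow> good u v (g (u, v)) \<and> g (v, u) = rev (g (u, v))"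
proof -
  obtain num :: "'a \<Rightarrow> nat" where inj: "inj_on num (pverts G)"
    using finite_imp_inj_to_nat_seg[OF pair_finite_verts] by blast
  obtain w where w: "\<And>u v. (u, v) \<in> parcs G \<Longrightarrow> good u v (w u v)"
    using assms(1) by metis
  define g where "g = (\<lambda>(u, v). if num u < num v then w u v else rev (w v u))"
  have "good u v (g (u, v)) \<and> g (v, u) = rev (g (u, v))" if uv: "(u, v) \<in> parcs G" for u v
  proof -
    have "num u \<noteq> num v"
      using inj wellformed'[OF uv] no_loop uv by (auto dest: inj_onD)
    then show ?thesis
      using uv w assms(2) parc_swap[OF uv] by (auto simp: g_def)
  qed
  then show ?thesis by blast
qed

text \<open>The words define a letter at each internal vertex unambiguously: it has one position on
  one path up to reversal, and \<open>g\<close> is compatible with reversal.\<close>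

lemma ex_letters:
  assumes len: "\<And>u v. (u, v) \<in> parcs G \<Longrightarrow> length (g (u, v)) = length (\<iota> (u, v))"
    and swap: "\<And>u v. (u, v) \<in> parcs G \<Longrightarrow> g (v, u) = rev (g (u, v))"
  shows "\<exists>l. (\<forall>u\<in>pverts G. l u = s u) \<and>
    (\<forall>u v. (u, v) \<in> parcs G \<longrightarrow> map l (epath (u, v)) = s u # g (u, v) @ [s v])"
proof -
  define occ where "occ x a \<longleftrightarrow> (\<exists>e\<in>parcs G. \<exists>i<length (\<iota> e). x = \<iota> e ! i \<and> a = g e ! i)" for x a
  have occ_unique: "a = g e ! i" if e: "e \<in> parcs G" and i: "i < length (\<iota> e)" and occ: "occ (\<iota> e ! i) a" for e i a
  proof -
    obtain e' j where e': "e' \<in> parcs G" and j: "j < length (\<iota> e')" "\<iota> e ! i = \<iota> e' ! j" "a = g e' ! j"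
      using occ by (auto simp: occ_def)
    then have "e' = e \<or> e' = prod.swap e"
      using same_edge[OF e e', of "\<iota> e ! i"] i j by (metis nth_mem)
    then show ?thesis
    proof
      assume "e' = e"
      then show ?thesis using j i distinct_\<iota>[OF e] by (auto simp: nth_eq_iff_index_eq)
    next
      assume "e' = prod.swap e"
      then have rev: "\<iota> e' = rev (\<iota> e)" "g e' = rev (g e)" "length (g e) = length (\<iota> e)"
        using \<iota>_swap[of "fst e" "snd e"] swap[of "fst e" "snd e"] len[of "fst e" "snd e"] e
        by (cases e; auto)+
      have "i = length (\<iota> e) - Suc j"
        using j i nth_eq_iff_index_eq[OF distinct_\<iota>[OF e], of i "length (\<iota> e) - Suc j"]
        by (auto simp: rev rev_nth)
      then show ?thesis using j by (auto simp: rev rev_nth)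
    qed
  qed
  define l where "l x = (if x \<in> pverts G then s x else SOME a. occ x a)" for x
  have l_new: "l (\<iota> e ! i) = g e ! i" if "e \<in> parcs G" "i < length (\<iota> e)" for e i
  proof -
    have "\<iota> e ! i \<notin> pverts G" using \<iota>_new[of e] that by (metis disjoint_iff nth_mem)
    moreover have "occ (\<iota> e ! i) (g e ! i)" using that by (auto simp: occ_def)
    then have "(SOME a. occ (\<iota> e ! i) a) = g e ! i"
      using occ_unique[OF that] by (rule someI2)
    ultimately show ?thesis by (simp add: l_def)
  qed
  have "map l (epath (u, v)) = s u # g (u, v) @ [s v]" if uv: "(u, v) \<in> parcs G" for u v
  proof -
    have "map l (\<iota> (u, v)) = g (u, v)"
      using l_new[OF uv] len[OF uv] by (intro nth_equalityI) simp_all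
    moreover have "l u = s u" "l v = s v"
      using wellformed'[OF uv] by (simp_all add: l_def)
    ultimately show ?thesis by (simp add: epath_def)
  qed
  moreover have "\<forall>u\<in>pverts G. l u = s u" by (simp add: l_def)
  ultimately show ?thesis by blast
qed

lemma length_\<iota>_swap: "(u, v) \<in> parcs G \<Longrightarrow> length (\<iota> (v, u)) = length (\<iota> (u, v))"
  by (simp add: \<iota>_swap)

lemma length_\<iota>_pos: "(u, v) \<in> parcs G \<Longrightarrow> 1 \<le> length (\<iota> (u, v))"
  using \<iota>_nonempty by (simp add: Suc_le_eq)

text \<open>Internal vertices are controlled by \<open>ok_word\<close> alone. At a vertex of
  \<open>G\<close> the conditions \<open>end_ok\<close> on its incident edges have to be
  combined.\<close>

lemma ex_crumby_coloring_of_vertex_letters: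
  assumes s_Bl: "\<And>u v w. s u = Bl \<Longrightarrow> (u, v) \<in> parcs G \<Longrightarrow> (u, w) \<in> parcs G \<Longrightarrow>
      2 \<le> length (\<iota> (u, v)) \<Longrightarrow> 2 \<le> length (\<iota> (u, w)) \<Longrightarrow> v = w"
    and m: "\<And>u. u \<in> pverts G \<Longrightarrow> s u \<noteq> Bl \<Longrightarrow> (u, m u) \<in> parcs G"
    and edge: "\<And>u v. (u, v) \<in> parcs G \<Longrightarrow> edge_ok (length (\<iota> (u, v))) (s u) (m u = v) (s v)"
    and both: "\<And>u v. (u, v) \<in> parcs G \<Longrightarrow> s u = Ce \<Longrightarrow> s v = Ce \<Longrightarrow> m u = v \<Longrightarrow> m v = u \<Longrightarrow>
      length (\<iota> (u, v)) = 4"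
  shows "\<exists>c. crumby_coloring S c"
proof -
  define good where "good u v = word_for (length (\<iota> (u, v))) (s u) (m u = v) (s v) (m v = u)" for u v
  have "\<exists>w. good u v w" if uv: "(u, v) \<in> parcs G" for u v
    unfolding good_def
  proof (rule ex_word)
    show "edge_ok (length (\<iota> (u, v))) (s v) (m v = u) (s u)"
      using edge[OF parc_swap[OF uv]] length_\<iota>_swap[OF uv] by simp
  qed (use uv length_\<iota>_pos edge both in auto)
  moreover have "good v u (rev w)" if "(u, v) \<in> parcs G" "good u v w" for u v w
    using that length_\<iota>_swap[of u v] word_for_rev by (auto simp: good_def)
  ultimately have "\<exists>g. \<forall>u v. (u, v) \<in> parcs G \<longrightarrow> good u v (g (u, v)) \<and> g (v, u) = rev (g (u, v))"
    by (rule ex_word_labelling)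
  then obtain g where g: "\<And>u v. (u, v) \<in> parcs G \<Longrightarrow> good u v (g (u, v))"
    and g_swap: "\<And>u v. (u, v) \<in> parcs G \<Longrightarrow> g (v, u) = rev (g (u, v))"
    by blast
  have len: "length (g (u, v)) = length (\<iota> (u, v))" if "(u, v) \<in> parcs G" for u v
    using g[OF that] by (simp add: good_def word_for_def)
  obtain l where l_old: "\<And>u. u \<in> pverts G \<Longrightarrow> l u = s u"
    and l_path: "\<And>u v. (u, v) \<in> parcs G \<Longrightarrow> map l (epath (u, v)) = s u # g (u, v) @ [s v]"
    using ex_letters[OF len g_swap, of s] by auto
  have first: "end_ok (length (\<iota> (u, v))) (s u) (m u = v) (l (hd (\<iota> (u, v))))" if "(u, v) \<in> parcs G" for u v
  proof -
    have "l (hd (\<iota> (u, v))) = hd (g (u, v))"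
      using l_path[OF that] \<iota>_nonempty[OF that] by (simp add: epath_def flip: hd_map)
    then show ?thesis using g[OF that] by (simp add: good_def word_for_def)
  qed
  have inner: "local_ok (l (epath e ! i)) (l (\<iota> e ! i)) (l (epath e ! Suc (Suc i)))"
    if e: "e \<in> parcs G" and i: "i < length (\<iota> e)" for e i
  proof -
    have "ok_word (map l (epath e))"
      using l_path[of "fst e" "snd e"] g[of "fst e" "snd e"] e by (simp add: good_def word_for_def)
    moreover have "\<iota> e ! i = epath e ! Suc i" using i by (simp add: epath_def nth_append)
    ultimately show ?thesis
      using i by (auto simp: ok_word_conv_nth length_epath)
  qed
  have old_or_new: "x \<in> pverts G \<or> (\<exists>e\<in>parcs G. \<exists>i<length (\<iota> e). x = \<iota> e ! i)" if "x \<in> pverts S" for x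
    using that by (auto simp: pverts_S in_set_conv_nth)
  have nbrs: "(\<iota> e ! i, epath e ! i) \<in> parcs S" "(\<iota> e ! i, epath e ! Suc (Suc i)) \<in> parcs S"
    if e: "e \<in> parcs G" and i: "i < length (\<iota> e)" for e i
  proof -
    have "\<iota> e ! i = epath e ! Suc i" using i by (simp add: epath_def nth_append)
    then show "(\<iota> e ! i, epath e ! i) \<in> parcs S" "(\<iota> e ! i, epath e ! Suc (Suc i)) \<in> parcs S"
      using parcs_S_swap[OF parcs_S_I[OF e, of i]] parcs_S_I[OF e, of "Suc i"] i
      by (simp_all add: length_epath)
  qed
  have "crumby_coloring S (\<lambda>x. if l x = Bl then Blue else Red)"
  proof (rule crumby_coloring_of_letters[OF finite_parcs_S parcs_S_subset parcs_S_swap])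
    fix x assume x: "x \<in> pverts S" "l x \<noteq> Bl"
    from old_or_new[OF x(1)] show "\<exists>y. (x, y) \<in> parcs S \<and> l y \<noteq> Bl"
    proof (elim disjE bexE exE conjE)
      assume "x \<in> pverts G"
      then have "(x, m x) \<in> parcs G" "s x \<noteq> Bl" using x m l_old by auto
      then show ?thesis
        using first[of x "m x"] old_neighbourI[of x "m x"] by (cases "s x") auto
    next
      fix e i assume "e \<in> parcs G" "i < length (\<iota> e)" "x = \<iota> e ! i"
      then show ?thesis
        using inner[of e i] nbrs[of e i] x by (cases "l x") auto
    qed
  next
    fix x y assume xy: "(x, y) \<in> parcs S" "l x = Ce"
    then have "x \<in> pverts S" using parcs_S_subset by auto
    from old_or_new[OF this] show "l y \<noteq> Ce"
    proof (elim disjE bexE exE conjE)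
      assume x: "x \<in> pverts G"
      then obtain v where "(x, v) \<in> parcs G" "y = hd (\<iota> (x, v))"
        using old_neighbour xy by blast
      then show ?thesis using first[of x v] x xy l_old[of x] by auto
    next
      fix e i assume "e \<in> parcs G" "i < length (\<iota> e)" "x = \<iota> e ! i"
      then show ?thesis
        using inner[of e i] new_neighbour[of e i y] xy by auto
    qed
  next
    fix x y z assume xyz: "(x, y) \<in> parcs S" "(x, z) \<in> parcs S" and l: "l x = Bl" "l y = Bl" "l z = Bl"
    then have "x \<in> pverts S" using parcs_S_subset by auto
    from old_or_new[OF this] show "y = z"
    proof (elim disjE bexE exE conjE)
      assume x: "x \<in> pverts G"
      then obtain v w where v: "(x, v) \<in> parcs G" "y = hd (\<iota> (x, v))"
        and w: "(x, w) \<in> parcs G" "z = hd (\<iota> (x, w))"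
        using old_neighbour xyz by metis
      \<comment> \<open>A blue first letter next to a blue vertex of \<open>G\<close> occurs only on
        a long edge, and there is at most one.\<close>
      then have "v = w" using first[of x v] first[of x w] x l l_old[of x] s_Bl[of x v w] by auto
      then show ?thesis using v w by simp
    next
      fix e i assume "e \<in> parcs G" "i < length (\<iota> e)" "x = \<iota> e ! i"
      then show ?thesis
        using inner[of e i] new_neighbour[of e i y] new_neighbour[of e i z] xyz l by auto
    qed
  next
    fix x y z assume xyz: "(x, y) \<in> parcs S" "(x, z) \<in> parcs S" and l: "l x = Le" "l y \<noteq> Bl" "l z \<noteq> Bl"
    then have "x \<in> pverts S" using parcs_S_subset by auto
    from old_or_new[OF this] show "y = z"
    proof (elim disjE bexE exE conjE)
      assume x: "x \<in> pverts G"
      then obtain v w where v: "(x, v) \<in> parcs G" "y = hd (\<iota> (x, v))"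
        and w: "(x, w) \<in> parcs G" "z = hd (\<iota> (x, w))"
        using old_neighbour xyz by metis
      \<comment> \<open>At a leaf, all incident edges except the one to \<open>m x\<close> start
        with \<open>Bl\<close>.\<close>
      then have "v = m x" "w = m x"
        using first[of x v] first[of x w] x l l_old[of x] by (auto split: if_splits)
      then show ?thesis using v w by simp
    next
      fix e i assume "e \<in> parcs G" "i < length (\<iota> e)" "x = \<iota> e ! i"
      then show ?thesis
        using inner[of e i] new_neighbour[of e i y] new_neighbour[of e i z] xyz l by auto
    qed
  qed
  then show ?thesis by blast
qed

lemma ex_crumby_coloring: "\<exists>c. crumby_coloring S c"
proof -
  have "parcs G \<subseteq> pverts G \<times> pverts G" using wellformed' by auto
  note finite_sub = pair_finite_verts this
  show ?thesis
    by (rule ex_vertex_letters[where k = "\<lambda>e. length (\<iota> e)", OF finite_sub],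
        fact parc_swap, fact no_loop, fact length_\<iota>_swap, fact length_\<iota>_pos)
       (rule ex_crumby_coloring_of_vertex_letters)
qed

end

theorem theorem2p5:
  fixes G S :: "'a pair_pre_digraph"
  assumes "pair_graph G"
    and "subcubic G"
    and "genuine_subdivision G S"
  shows "\<exists>c. crumby_coloring S c"
proof -
  obtain \<iota> where \<iota>:
    "\<forall>(u, v) \<in> parcs G. \<iota> (v, u) = rev (\<iota> (u, v)) \<and> \<iota> (u, v) \<noteq> [] \<and> distinct (\<iota> (u, v)) \<and>
        set (\<iota> (u, v)) \<inter> pverts G = {}"
    "\<forall>(u, v) \<in> parcs G. \<forall>(x, y) \<in> parcs G.
        {u, v} \<noteq> {x, y} \<longrightarrow> set (\<iota> (u, v)) \<inter> set (\<iota> (x, y)) = {}"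
    "pverts S = pverts G \<union> (\<Union>e \<in> parcs G. set (\<iota> e))"
    "parcs S = (\<Union>(u, v) \<in> parcs G. set (vwalk_arcs (u # \<iota> (u, v) @ [v])))"
    using assms(3) unfolding genuine_subdivision_def by (elim exE conjE)
  interpret pair_graph G by (fact assms(1))
  have \<iota>_arc: "\<iota> (v, u) = rev (\<iota> (u, v)) \<and> \<iota> (u, v) \<noteq> [] \<and> distinct (\<iota> (u, v)) \<and>
      set (\<iota> (u, v)) \<inter> pverts G = {}" if "(u, v) \<in> parcs G" for u v
    using bspec[OF \<iota>(1) that] by simp
  interpret subdivided_graph G S \<iota>
  proof unfold_locales
    fix u v x y assume "(u, v) \<in> parcs G" "(x, y) \<in> parcs G" "{u, v} \<noteq> {x, y}"
    then show "set (\<iota> (u, v)) \<inter> set (\<iota> (x, y)) = {}"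
      using bspec[OF \<iota>(2), of "(u, v)"] by (auto dest: bspec[where x = "(x, y)"])
  next
    fix e assume "e \<in> parcs G"
    then show "\<iota> e \<noteq> []" "distinct (\<iota> e)" "set (\<iota> e) \<inter> pverts G = {}"
      using \<iota>_arc by (cases e; simp)+
  qed (use \<iota>_arc in \<open>simp\<close>, fact+)
  show ?thesis by (fact ex_crumby_coloring)
qed

end
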